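(* Let $j$ and $e$ be integers such that $j\ge 4$, $j\ne 6$, and $e\ge 1$. Then the sequence $\mathcal{F}^e(F_j)=(F_i^e \bmod F_j : i\ge 0)$ is periodic and its periodicity $\pi(F_j,e)$ is as follows. (i) Assume that $j$ is even. (i.1) If $e$ is even, then $\pi(F_j,e)=j$; (i.2) if $e$ is odd, then $\pi(F_j,e)=2j$. (ii) Assume that $j$ is odd. (ii.1) If $e\equiv 0\pmod 4$, then $\pi(F_j,e)=j$; (ii.2) if $e\equiv 2\pmod 4$, then $\pi(F_j,e)=2j$; (ii.3) if $e$ is odd, then $\pi(F_j,e)=4j$.
   Context: The Fibonacci numbers are $F_0=0$, $F_1=1$, $F_{i+1}=F_i+F_{i-1}$ for $i\ge 1$. For integers $j\ge 1$, $e\ge 1$, $\mathcal{F}^e(F_j)$ denotes the sequence $(F_i^e \bmod F_j : i\ge 0)$ of residues of $F_i^e$ modulo $F_j$. A sequence $(a_i:i\ge 0)$ is periodic if there is an integer $p\ge 1$, called a period, with $a_{i+p}=a_i$ for all $i\ge 0$. The periodicity $\pi(F_j,e)$ is the minimum period of $\mathcal{F}^e(F_j)$. *)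

theory Defs
  imports "HOL-Number_Theory.Fib"
begin

definition is_period :: "(nat \<Rightarrow> 'a) \<Rightarrow> nat \<Rightarrow> bool" where
  "is_period a p \<longleftrightarrow> p \<ge> 1 \<and> (\<forall>i. a (i + p) = a i)"

definition periodic_seq :: "(nat \<Rightarrow> 'a) \<Rightarrow> bool" where
  "periodic_seq a \<longleftrightarrow> (\<exists>p. is_period a p)"

(* Only meaningful if a is periodic; otherwise LEAST yields an unspecified value. *)
definition periodicity :: "(nat \<Rightarrow> 'a) \<Rightarrow> nat" where
  "periodicity a = (LEAST p. is_period a p)"

definition fib_pow_seq :: "nat \<Rightarrow> nat \<Rightarrow> nat \<Rightarrow> nat" where
  "fib_pow_seq e j = (\<lambda>i. fib i ^ e mod fib j)"

(* The periodicity \<pi>(F_j, e); the first argument is the index j, not the modulus F_j. *)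
definition fib_periodicity :: "nat \<Rightarrow> nat \<Rightarrow> nat" where
  "fib_periodicity j e = periodicity (fib_pow_seq e j)"

end

(* Modulo F_j, shifting the index by j multiplies F_i by c = F_(j-1), and Cassini's identity gives
   c^2 = (-1)^j. Hence k * j is a period iff c^(k e) = 1 modulo F_j, where c has order 2 or 4.
   Every period p is a multiple of j: F_j divides F_p^e, so every prime factor of F_j divides
   F_d with d = gcd p j. If d < j, one may take j = q * d with q prime; the binomial expansion of
   Q = F_(q d) / F_d shows that Q is a power of q, not divisible by q^2 (q odd) or by 8 (q = 2),
   which contradicts the size of Q unless j = 6. *)
theory Submission
  imports Defs "HOL-Number_Theory.Cong" "HOL-Computational_Algebra.Primes"
begin

section \<open>Growth and divisibility of Fibonacci numbers\<close>

lemma fib_ge_pred: "n \<le> fib n + 1"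
proof (induction n rule: fib.induct)
  case (3 n)
  show ?case
  proof (cases "n \<le> 1")
    case True
    then have "n = 0 \<or> n = 1" by auto
    then show ?thesis by auto
  next
    case False
    then have "fib n \<ge> 1" using fib_neq_0_nat[of n] by simp
    then show ?thesis using 3 by simp
  qed
qed auto

lemma dvd_imp_fib_dvd: "m dvd n \<Longrightarrow> fib m dvd fib n"
  by (metis fib_gcd gcd_dvd2 gcd_nat.absorb1)

section \<open>The quotient of F_(kp) by F_p, to second order in F_p\<close>

text \<open>In the addition formula for the step from k to k + 1, the term F_p * F_(kp) contains F_p
  twice, so only multiplication by F_(p+1) survives.\<close>

lemma cong_fib_mult_1:
  "[int (fib (k * p + 1)) = int (fib (p + 1)) ^ k] (mod (int (fib p))\<^sup>2)"
proof (induction k)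
  case (Suc k)
  have "fib p dvd fib (k * p)"
    by (rule dvd_imp_fib_dvd) simp
  then obtain v where v: "fib (k * p) = fib p * v" by blast
  have "fib (Suc k * p + 1) = fib (p + 1) * fib (k * p + 1) + fib p * fib (k * p)"
    using fib_add[of "k * p" p] by (simp add: add.commute)
  then have eq: "int (fib (Suc k * p + 1)) =
      int (fib (p + 1)) * int (fib (k * p + 1)) + (int (fib p))\<^sup>2 * int v"
    unfolding v by (simp add: power2_eq_square)
  have "[int (fib (p + 1)) * int (fib (k * p + 1)) + (int (fib p))\<^sup>2 * int v
      = int (fib (p + 1)) * int (fib (p + 1)) ^ k + 0] (mod (int (fib p))\<^sup>2)"
    by (intro cong_add cong_mult Suc.IH) (simp_all add: cong_0_iff)
  then show ?case unfolding eq by simp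
qed simp

text \<open>Binomial expansion of the quotient of two Fibonacci numbers to second order; the factor
  \<open>(fib (p + 1))\<^sup>2\<close> avoids truncated exponents.\<close>
lemma fib_mult_quotient:
  "\<exists>u::int. int (fib (k * p)) = int (fib p) * u \<and>
    [(int (fib (p + 1)))\<^sup>2 * u = int k * int (fib (p + 1)) ^ (k + 1)
      - int (k choose 2) * int (fib p) * int (fib (p + 1)) ^ k] (mod (int (fib p))\<^sup>2)"
proof (induction k)
  case 0
  show ?case by (intro exI[of _ 0]) (simp add: binomial_eq_0)
next
  case (Suc k)
  define A b where "A = int (fib (p + 1))" and "b = int (fib p)"
  define y where "y = int (fib (k * p + 1))"
  from Suc.IH obtain u where u: "int (fib (k * p)) = b * u"
    and cu: "[A\<^sup>2 * u = int k * A ^ (k + 1) - int (k choose 2) * b * A ^ k] (mod b\<^sup>2)"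
    unfolding A_def b_def by blast
  have cy: "[y = A ^ k] (mod b\<^sup>2)"
    unfolding A_def b_def y_def by (rule cong_fib_mult_1)
  \<comment> \<open>The recurrence for the quotient comes from the addition formula with F_(p-1)
    written as \<open>A - b\<close>, which needs p > 0; for p = 0 both sides vanish.\<close>
  have "int (fib (Suc k * p)) = b * (u * (A - b) + y)"
  proof (cases p)
    case 0
    then show ?thesis by (simp add: b_def)
  next
    case (Suc n)
    have "fib (Suc k * p) = fib (k * p + 1) * fib p + fib (k * p) * fib n"
      using fib_add[of n "k * p"] by (simp add: Suc add.commute add.left_commute)
    moreover have "int (fib n) = A - b" by (simp add: A_def b_def Suc)
    ultimately have "int (fib (Suc k * p)) = y * b + (b * u) * (A - b)"
      unfolding y_def u[symmetric] by (simp add: b_def)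
    then show ?thesis by (simp add: algebra_simps)
  qed
  moreover have "[A\<^sup>2 * (u * (A - b) + y) =
      int (Suc k) * A ^ (Suc k + 1) - int (Suc k choose 2) * b * A ^ Suc k] (mod b\<^sup>2)"
  proof -
    from cu obtain s where s:
      "A\<^sup>2 * u = int k * A ^ (k + 1) - int (k choose 2) * b * A ^ k + b\<^sup>2 * s"
      using cong_sym[OF cu] unfolding cong_iff_lin by (auto simp: mult.commute)
    from cy obtain t where t: "y = A ^ k + b\<^sup>2 * t"
      using cong_sym[OF cy] unfolding cong_iff_lin by (auto simp: mult.commute)
    \<comment> \<open>Pascal's rule: the extra \<open>k\<close> is produced by \<open>- b\<close>
      multiplying the leading term \<open>int k * A ^ (k + 1)\<close>.\<close>
    have ch: "int (Suc k choose 2) = int (k choose 2) + int k"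
      by (simp add: numeral_2_eq_2)
    have "A\<^sup>2 * (u * (A - b) + y) = (A\<^sup>2 * u) * (A - b) + A\<^sup>2 * y"
      by (simp add: algebra_simps)
    also have "\<dots> = int (Suc k) * A ^ (Suc k + 1) - int (Suc k choose 2) * b * A ^ Suc k
        + b\<^sup>2 * (int (k choose 2) * A ^ k + s * (A - b) + A\<^sup>2 * t)"
      unfolding s t ch by (simp add: algebra_simps power2_eq_square)
    finally show ?thesis by (simp add: cong_iff_dvd_diff)
  qed
  ultimately show ?case unfolding A_def b_def by blast
qed

section \<open>Cassini's identity and Lucas numbers modulo 8\<close>

text \<open>Cassini's identity with F_(n-1) eliminated: the left side is the norm of F_(n+1) - F_n *
  phi, the n-th power of the conjugate of the golden ratio phi, which has norm -1.\<close>

lemma fib_Cassini_norm_form: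
  "(int (fib (n + 1)))\<^sup>2 - int (fib (n + 1)) * int (fib n) - (int (fib n))\<^sup>2 = (- 1) ^ n"
proof (induction n)
  case (Suc n)
  then show ?case by (simp add: algebra_simps power2_eq_square)
qed simp

text \<open>The left-hand side is the Lucas number with index \<open>n\<close>.\<close>
lemma not_8_dvd_lucas: "\<not> 8 dvd 2 * int (fib (n + 1)) - int (fib n)"
proof
  define y where "y = int (fib (n + 1))"
  assume "8 dvd 2 * int (fib (n + 1)) - int (fib n)"
  then obtain t where t: "int (fib n) = 2 * y - 8 * t"
    unfolding y_def by (elim dvdE) (auto simp: algebra_simps intro: that)
  have "y\<^sup>2 - y * (2 * y - 8 * t) - (2 * y - 8 * t)\<^sup>2 = (- 1) ^ n"
    using fib_Cassini_norm_form[of n] unfolding t y_def[symmetric] .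
  \<comment> \<open>Substituting F_n = 2y - 8t turns Cassini's identity into -5 y^2 = 1 or -1 modulo
    8.\<close>
  then have e: "- 5 * y\<^sup>2 + 8 * (5 * y * t - 8 * t\<^sup>2) = (- 1) ^ n"
    by (simp add: algebra_simps power2_eq_square)
  obtain m where m: "y = 2 * m \<or> y = 2 * m + 1" by (metis oddE evenE)
  have pm: "(- 1 :: int) ^ n = 1 \<or> (- 1 :: int) ^ n = - 1" by (simp add: minus_one_power_iff)
  \<comment> \<open>Squares are 0, 1 or 4 modulo 8, so -5 y^2 is 0, 3 or 4 there, never 1 or
    -1.\<close>
  obtain z where z: "y\<^sup>2 = 4 * z \<or> y\<^sup>2 = 8 * z + 1"
  proof -
    have "even (m * (m + 1))" by simp
    then obtain w where "m * (m + 1) = 2 * w" by (elim evenE)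
    then have "y\<^sup>2 = 4 * m\<^sup>2 \<or> y\<^sup>2 = 8 * w + 1" using m
      by (auto simp: power2_eq_square algebra_simps)
    then show ?thesis using that by blast
  qed
  define x where "x = 5 * y * t - 8 * t\<^sup>2"
  have "- 5 * y\<^sup>2 + 8 * x = 1 \<or> - 5 * y\<^sup>2 + 8 * x = - 1"
    using e pm unfolding x_def by auto
  then show False using z by presburger
qed

section \<open>New prime factors of Fibonacci numbers\<close>

lemma dvd_of_dvd_diff:
  fixes a x y z :: int
  assumes "a dvd x - (y - z)" "a dvd x" "a dvd z"
  shows "a dvd y"
proof -
  have "y = x - (x - (y - z)) + z" by simp
  then show ?thesis using assms by (metis dvd_add dvd_diff)
qed

text \<open>A counterexample would make every prime factor of F_(qp) / F_p equal to q, with too few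
  factors q for the size of the quotient. The excluded case q = 2, p = 3 is a true exception: F_6 =
  8 and F_3 = 2.\<close>

lemma fib_prime_mult_new_prime:
  fixes p q :: nat
  assumes q: "prime q" and p: "p \<ge> 3" and ex: "q * p \<noteq> 6"
  shows "\<exists>r. prime r \<and> r dvd fib (q * p) \<and> \<not> r dvd fib p"
proof (rule ccontr)
  assume "\<not> ?thesis"
  then have all: "r dvd fib p" if "prime r" "r dvd fib (q * p)" for r using that by blast
  define A b where "A = int (fib (p + 1))" and "b = int (fib p)"
  have q2: "q \<ge> 2" using q by (rule prime_ge_2_nat)
  have b0: "fib p > 0" using p by (intro fib_neq_0_nat) auto
  obtain u where u: "int (fib (q * p)) = b * u"
    and cu: "[A\<^sup>2 * u = int q * A ^ (q + 1) - int (q choose 2) * b * A ^ q] (mod b\<^sup>2)"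
    using fib_mult_quotient[of q p] unfolding A_def b_def by blast
  have fqp: "fib (q * p) > 0" using p q2 by (intro fib_neq_0_nat) auto
  have "u > 0"
  proof -
    have "b * u > 0" using fqp u by linarith
    then show ?thesis using b0 by (simp add: b_def zero_less_mult_iff)
  qed
  then obtain Q where Q: "u = int Q" "Q > 0" using zero_less_imp_eq_int by blast
  have fQ: "fib (q * p) = fib p * Q"
    using u unfolding b_def Q(1) by (metis of_nat_eq_iff of_nat_mult)
  \<comment> \<open>This coprimality allows powers of \<open>A\<close> to be cancelled modulo primes
    dividing F_p.\<close>
  have copA: "coprime (int r) A" if "prime r" "r dvd fib p" for r
  proof -
    have "coprime (fib p) (fib (p + 1))" using coprime_fib_Suc_nat[of p] by simp
    then have "coprime r (fib (p + 1))" using that(2) coprime_divisors dvd_refl by blast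
    then show ?thesis by (simp add: A_def)
  qed
  \<comment> \<open>Modulo r, which divides \<open>b\<close>, the expansion keeps only its leading
    term q * A^(q+1); as r divides \<open>u\<close>, it must divide q.\<close>
  have only: "r = q \<and> q dvd fib p" if r: "prime r" "r dvd Q" for r
  proof -
    have rb: "r dvd fib p" using all[OF r(1)] r(2) fQ by simp
    then have rbi: "int r dvd b" by (simp add: b_def)
    have "int r dvd A\<^sup>2 * u - (int q * A ^ (q + 1) - int (q choose 2) * b * A ^ q)"
      using cu rbi unfolding cong_iff_dvd_diff
      by (metis dvd_trans dvd_triv_left power2_eq_square)
    moreover have "int r dvd A\<^sup>2 * u" using r(2) Q(1) by simp
    moreover have "int r dvd int (q choose 2) * b * A ^ q" using rbi by simp
    ultimately have "int r dvd int q * A ^ (q + 1)"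
      by (rule dvd_of_dvd_diff)
    moreover have "coprime (int r) (A ^ (q + 1))"
      using copA[OF r(1) rb] by (simp add: coprime_power_right_iff)
    ultimately have "r dvd q" by (simp add: coprime_dvd_mult_left_iff)
    then show ?thesis using r(1) q rb primes_dvd_imp_eq by blast
  qed
  have "fib (q * p) \<ge> fib ((q - 1) * p + 1) * fib p"
  proof -
    have "q * p = Suc ((p - 1) + (q - 1) * p)" using p q2 by (cases q; cases p) auto
    then have "fib (q * p) = fib ((q - 1) * p + 1) * fib p + fib ((q - 1) * p) * fib (p - 1)"
      using fib_add[of "p - 1" "(q - 1) * p"] p by simp
    then show ?thesis by simp
  qed
  then have "Q \<ge> fib ((q - 1) * p + 1)" using b0 unfolding fQ by simp
  moreover have "(q - 1) * p \<le> fib ((q - 1) * p + 1)" using fib_ge_pred[of "(q - 1) * p + 1"] by simp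
  ultimately have Qp: "(q - 1) * p \<le> Q" by simp
  moreover have "(q - 1) * 3 \<le> (q - 1) * p" using p by simp
  \<comment> \<open>Since Q exceeds q and has no prime factor other than q, it is divisible by
    q^2.\<close>
  ultimately have Qq: "Q > q" using q2 by linarith
  then have "Q \<noteq> 1" using q2 by linarith
  then obtain r where r: "prime r" "r dvd Q" using prime_factor_nat by blast
  then have qQ: "q dvd Q" and qb: "q dvd fib p" using only by blast+
  obtain m where m: "Q = q * m" using qQ by (elim dvdE)
  have "m \<noteq> 1" using Qq m by auto
  then obtain r where r: "prime r" "r dvd m" using prime_factor_nat by blast
  then have "q dvd m" using only[of r] m by auto
  then obtain m' where m': "m = q * m'" by (elim dvdE)
  show False
  proof (cases "q = 2")
    case True
    have p4: "p \<ge> 4" using ex p True by simp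
    \<comment> \<open>For q = 2 the quotient is the Lucas number L_p, a power of 2 divisible by 4
      but not by 8. So it is 4, although it is at least F_5 = 5 when p >= 4.\<close>
    have "2 * A - b = u"
    proof -
      have "fib (q * p) = (2 * fib (p - 1) + fib p) * fib p"
        using fib_rec_even'[of p] True by simp
      then have "Q = 2 * fib (p - 1) + fib p" using fQ b0 by simp
      moreover have "fib (p + 1) = fib p + fib (p - 1)" using p by (cases p) auto
      ultimately show ?thesis using Q(1) by (simp add: A_def b_def)
    qed
    then have n8: "\<not> 8 dvd Q" using not_8_dvd_lucas[of p] Q(1) unfolding A_def b_def
      by (metis of_nat_dvd_iff of_nat_numeral)
    have "m' = 1"
    proof (rule ccontr)
      assume "m' \<noteq> 1"
      then obtain r where r: "prime r" "r dvd m'" using prime_factor_nat by blast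
      then have "q dvd m'" using only[of r] m m' by auto
      then show False using n8 m m' True by auto
    qed
    then have Q4: "Q = 4" using m m' True by simp
    have "5 \<le> p + 1" using p4 by simp
    then have "fib 5 \<le> fib (p + 1)" by (rule fib_mono)
    moreover have "fib 5 = 5" by (simp add: eval_nat_numeral)
    moreover have "fib (p + 1) \<le> Q"
      using \<open>Q \<ge> fib ((q - 1) * p + 1)\<close> True by simp
    ultimately show False using Q4 by simp
  next
    case False
    \<comment> \<open>For odd q both \<open>q choose 2\<close> and F_p are divisible by q, so q^2
      divides the second-order term. Then q^2 would divide q * A^(q+1), against coprimality of q and
      \<open>A\<close>.\<close>
    then have "odd q" using q q2 prime_odd_nat by force
    have "int q * int q dvd A\<^sup>2 * u" using Q(1) m m' by simp
    moreover have "int q * int q dvd int (q choose 2) * b * A ^ q"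
    proof -
      obtain h where h: "q = 2 * h + 1" using \<open>odd q\<close> by (elim oddE)
      have "q choose 2 = q * h" by (simp add: choose_two h)
      then have "int q dvd int (q choose 2)" by simp
      moreover have "int q dvd b" using qb by (simp add: b_def)
      ultimately show ?thesis by (intro dvd_mult2 mult_dvd_mono)
    qed
    moreover have "int q * int q dvd A\<^sup>2 * u - (int q * A ^ (q + 1) - int (q choose 2) * b * A ^ q)"
    proof -
      have "int q * int q dvd b\<^sup>2" using qb by (simp add: b_def power2_eq_square mult_dvd_mono)
      then show ?thesis using cu unfolding cong_iff_dvd_diff by (rule dvd_trans)
    qed
    ultimately have "int q * int q dvd int q * A ^ (q + 1)"
      by - (rule dvd_of_dvd_diff)
    then have "int q dvd A ^ (q + 1)" using q2 by simp
    moreover have "coprime (int q) (A ^ (q + 1))"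
      using copA[OF q qb] by (simp add: coprime_power_right_iff)
    ultimately have "is_unit (int q)" using coprime_absorb_left by blast
    then show False using q2 by simp
  qed
qed

text \<open>For a prime q dividing j / d, the index p = j / q is a multiple of d, so F_d divides F_p
  and a prime not dividing F_p suffices.\<close>

lemma fib_proper_divisor_new_prime:
  fixes d j :: nat
  assumes "d dvd j" "d < j" "j \<ge> 3" "j \<noteq> 6"
  shows "\<exists>r. prime r \<and> r dvd fib j \<and> \<not> r dvd fib d"
proof -
  obtain k where k: "j = d * k" using assms(1) by (elim dvdE)
  have "k \<noteq> 1" using assms(2) k by auto
  then obtain q where q: "prime q" "q dvd k" using prime_factor_nat by blast
  then obtain l where l: "k = q * l" by (elim dvdE)
  define p where "p = d * l"
  have j: "j = q * p" by (simp add: k l p_def)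
  have dp: "fib d dvd fib p"
    by (rule dvd_imp_fib_dvd) (simp add: p_def)
  have "\<exists>r. prime r \<and> r dvd fib j \<and> \<not> r dvd fib p"
  proof (cases "p \<ge> 3")
    case True
    then show ?thesis using fib_prime_mult_new_prime[OF q(1), of p] assms(4) j by simp
  next
    case False
    have "p \<noteq> 0" by (rule notI) (use assms(3) j in simp)
    \<comment> \<open>At these indices F_p = 1, so any prime factor of F_j is new.\<close>
    with False have "p = 1 \<or> p = 2" by auto
    then have 1: "fib p = 1" by auto
    have "fib 3 \<le> fib j" using assms(3) by (rule fib_mono)
    then have "fib j \<noteq> 1" by (simp add: eval_nat_numeral)
    then obtain r where "prime r" "r dvd fib j" using prime_factor_nat by blast
    then show ?thesis unfolding 1 by (auto dest: prime_gt_1_nat)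
  qed
  then show ?thesis using dp dvd_trans by blast
qed

section \<open>Index shifts and the order of F_(j-1) modulo F_j\<close>

lemma cong_fib_add_mult:
  "[int (fib (i + k * Suc n)) = int (fib n) ^ k * int (fib i)] (mod int (fib (Suc n)))"
proof (induction k)
  case (Suc k)
  have "fib (i + Suc k * Suc n) =
      fib (Suc (i + k * Suc n)) * fib (Suc n) + fib (i + k * Suc n) * fib n"
    using fib_add[of n "i + k * Suc n"] by (simp add: ac_simps)
  then have "[int (fib (i + Suc k * Suc n)) = int (fib n) * int (fib (i + k * Suc n))]
      (mod int (fib (Suc n)))"
    by (simp add: cong_iff_dvd_diff)
  also have "[int (fib n) * int (fib (i + k * Suc n)) = int (fib n) * (int (fib n) ^ k * int (fib i))]
      (mod int (fib (Suc n)))"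
    by (intro cong_mult Suc.IH) simp
  finally show ?case by (simp add: mult.assoc)
qed simp

lemma cong_fib_square:
  "[(int (fib n))\<^sup>2 = (- 1) ^ Suc n] (mod int (fib (Suc n)))"
proof -
  have "(int (fib n))\<^sup>2 - (- 1) ^ Suc n = int (fib (Suc n)) * (int (fib (Suc n)) - int (fib n))"
    using fib_Cassini_norm_form[of n] by (simp add: algebra_simps power2_eq_square)
  then show ?thesis by (simp add: cong_iff_dvd_diff)
qed

text \<open>F_n has order exactly 2: its square is 1 by Cassini, and it is not 1 itself.\<close>

lemma fib_pow_cong_1_even:
  assumes "Suc n \<ge> 4" "even (Suc n)"
  shows "[int (fib n) ^ m = 1] (mod int (fib (Suc n))) \<longleftrightarrow> even m"
proof -
  let ?F = "int (fib (Suc n))"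
  have sq: "[(int (fib n))\<^sup>2 = 1] (mod ?F)" using cong_fib_square[of n] assms(2) by simp
  have ev: "[int (fib n) ^ (2 * h) = 1] (mod ?F)" for h
    using cong_pow[OF sq, of h] by (simp add: power_mult)
  show ?thesis
  proof
    assume c: "[int (fib n) ^ m = 1] (mod ?F)"
    show "even m"
    proof (rule ccontr)
      assume "odd m"
      then obtain h where h: "m = 2 * h + 1" by (elim oddE)
      have "[int (fib n) ^ m = 1 * int (fib n)] (mod ?F)"
        unfolding h power_add power_one_right by (intro cong_mult ev cong_refl)
      then have "[int (fib n) = 1] (mod ?F)" using cong_trans[OF cong_sym c] by simp
      \<comment> \<open>Both F_n and 1 lie between 0 and F_(n+1) - 1, so congruence would force F_n
        = 1, which F_n >= F_3 = 2 excludes.\<close>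
      moreover have "fib 3 \<le> fib n" using assms(1) by (intro fib_mono) simp
      then have "fib n \<ge> 2" by (simp add: eval_nat_numeral)
      moreover have "fib (n - 1) > 0" using assms(1) by (intro fib_neq_0_nat) simp
      moreover have "fib (Suc n) = fib n + fib (n - 1)" using assms by (cases n) auto
      ultimately show False
        using cong_less_imp_eq_int[of "int (fib n)" ?F 1] by simp
    qed
  next
    assume "even m"
    then show "[int (fib n) ^ m = 1] (mod ?F)" using ev by (elim evenE) simp
  qed
qed

text \<open>F_n has order exactly 4: its square is -1 by Cassini, and -1 differs from 1 because the
  modulus is at least F_4 = 3.\<close>

lemma fib_pow_cong_1_odd:
  assumes "Suc n \<ge> 4" "odd (Suc n)"
  shows "[int (fib n) ^ m = 1] (mod int (fib (Suc n))) \<longleftrightarrow> 4 dvd m"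
proof -
  let ?F = "int (fib (Suc n))"
  have sq: "[(int (fib n))\<^sup>2 = - 1] (mod ?F)" using cong_fib_square[of n] assms(2) by simp
  have ev: "[int (fib n) ^ (2 * h) = (- 1) ^ h] (mod ?F)" for h
    using cong_pow[OF sq, of h] by (simp add: power_mult)
  have n1: "\<not> [- 1 = 1] (mod ?F)"
  proof
    assume "[- 1 = 1] (mod ?F)"
    then have "?F dvd 2" by (simp add: cong_iff_dvd_diff)
    then have "?F \<le> 2" by (rule zdvd_imp_le) simp
    moreover have "fib 4 \<le> fib (Suc n)" using assms(1) by (rule fib_mono)
    ultimately show False by (simp add: eval_nat_numeral)
  qed
  show ?thesis
  proof
    assume c: "[int (fib n) ^ m = 1] (mod ?F)"
    have "even m"
    proof (rule ccontr)
      assume "odd m"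
      \<comment> \<open>Squaring gives 1, while the power of the square F_n^2 = -1 gives (-1)^m = -1
        for odd m.\<close>
      have "[int (fib n) ^ (2 * m) = 1] (mod ?F)"
        using cong_pow[OF c, of 2] by (simp add: power_mult[symmetric] mult.commute)
      moreover have "[- 1 = int (fib n) ^ (2 * m)] (mod ?F)"
        using cong_sym[OF ev[of m]] \<open>odd m\<close> by simp
      ultimately have "[- 1 = 1] (mod ?F)" by (rule cong_trans[rotated])
      then show False using n1 by blast
    qed
    then obtain h where h: "m = 2 * h" by (elim evenE)
    have "[(- 1) ^ h = 1] (mod ?F)" using cong_trans[OF cong_sym[OF ev[of h]]] c h by blast
    then have "even h" using n1 by (metis minus_one_power_iff)
    then show "4 dvd m" using h by auto
  next
    assume "4 dvd m"
    then obtain h where "m = 2 * (2 * h)" by (auto elim!: dvdE)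
    then show "[int (fib n) ^ m = 1] (mod ?F)" using ev[of "2 * h"] by (simp add: power_mult)
  qed
qed

section \<open>Characterization of the periods\<close>

lemma is_period_fib_pow_seq_iff:
  assumes "j \<ge> 4" "j \<noteq> 6" "e \<ge> 1"
  shows "is_period (fib_pow_seq e j) P \<longleftrightarrow>
    (\<exists>k\<ge>1. P = k * j \<and> [int (fib (j - 1)) ^ (k * e) = 1] (mod int (fib j)))"
proof
  obtain n where n: "j = Suc n" using assms(1) by (cases j) auto
  have step: "[int (fib (i + k * j)) ^ e = int (fib (j - 1)) ^ (k * e) * int (fib i) ^ e]
      (mod int (fib j))" for i k
    using cong_pow[OF cong_fib_add_mult[of i k n], of e]
    by (simp add: n power_mult power_mult_distrib)
  have per: "is_period (fib_pow_seq e j) P \<longleftrightarrow>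
      P \<ge> 1 \<and> (\<forall>i. [int (fib (i + P)) ^ e = int (fib i) ^ e] (mod int (fib j)))" for P
    unfolding is_period_def fib_pow_seq_def
    by (simp add: cong_int_iff[symmetric] cong_def[symmetric])
  {
    assume P: "is_period (fib_pow_seq e j) P"
    have "j dvd P"
    proof (rule ccontr)
      assume nd: "\<not> j dvd P"
      have "gcd P j \<noteq> j" using nd by (metis gcd_dvd1)
      then have lt: "gcd P j < j" using assms(1) by (simp add: gcd_le2_nat le_neq_implies_less)
      have "gcd P j dvd j" by simp
      then obtain r where r: "prime r" "r dvd fib j" "\<not> r dvd fib (gcd P j)"
        using fib_proper_divisor_new_prime[OF _ lt] assms by auto
      \<comment> \<open>The index i = 0 yields that F_j divides F_P^e, because 0^e = 0 for e >= 1.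
        The new prime r then divides both F_P and F_j, hence F_(gcd P j).\<close>
      have "[int (fib (0 + P)) ^ e = int (fib 0) ^ e] (mod int (fib j))"
        using P unfolding per by blast
      then have "[int (fib P ^ e) = 0] (mod int (fib j))" using assms(3) by (simp add: zero_power)
      then have "int (fib j) dvd int (fib P ^ e)" unfolding cong_0_iff .
      then have "fib j dvd fib P ^ e" by (simp only: of_nat_dvd_iff)
      then have "r dvd fib P" using r(1,2) prime_dvd_power dvd_trans by blast
      then show False using r by (simp add: fib_gcd)
    qed
    then obtain k where k: "P = k * j" by (metis dvdE mult.commute)
    moreover have "k \<ge> 1" using P k unfolding per by (cases k) auto
    \<comment> \<open>The index i = 1 isolates the power of F_(j-1), since F_1 = 1.\<close>
    moreover have "[int (fib (1 + P)) ^ e = int (fib 1) ^ e] (mod int (fib j))"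
      using P unfolding per by blast
    then have "[int (fib (j - 1)) ^ (k * e) = 1] (mod int (fib j))"
      using step[of 1 k] unfolding k by (simp add: cong_def)
    ultimately show "\<exists>k\<ge>1. P = k * j \<and> [int (fib (j - 1)) ^ (k * e) = 1] (mod int (fib j))"
      by blast
  }
  {
    assume "\<exists>k\<ge>1. P = k * j \<and> [int (fib (j - 1)) ^ (k * e) = 1] (mod int (fib j))"
    then obtain k where k: "k \<ge> 1" "P = k * j"
      and c: "[int (fib (j - 1)) ^ (k * e) = 1] (mod int (fib j))" by blast
    have "[int (fib (i + k * j)) ^ e = int (fib i) ^ e] (mod int (fib j))" for i
      using cong_trans[OF step[of i k] cong_mult[OF c cong_refl]] by simp
    moreover have "P \<ge> 1" using k assms(1) by simp
    ultimately show "is_period (fib_pow_seq e j) P" unfolding per k(2) by blast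
  }
qed

lemma fib_periodicity_eqI:
  assumes "j \<ge> 4" "j \<noteq> 6" "e \<ge> 1" "K \<ge> 1"
    and "\<And>k. [int (fib (j - 1)) ^ (k * e) = 1] (mod int (fib j)) \<longleftrightarrow> K dvd k"
  shows "is_period (fib_pow_seq e j) (K * j)" "fib_periodicity j e = K * j"
proof -
  have iff: "is_period (fib_pow_seq e j) P \<longleftrightarrow> (\<exists>k\<ge>1. P = k * j \<and> K dvd k)" for P
    using is_period_fib_pow_seq_iff[OF assms(1-3)] assms(5) by simp
  show per: "is_period (fib_pow_seq e j) (K * j)" unfolding iff by (intro exI[of _ K] conjI assms(4) refl dvd_refl)
  show "fib_periodicity j e = K * j"
    unfolding fib_periodicity_def periodicity_def
  proof (rule Least_equality)
    show "is_period (fib_pow_seq e j) (K * j)" by (rule per)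
  next
    fix P assume "is_period (fib_pow_seq e j) P"
    then show "K * j \<le> P" unfolding iff
      by (elim exE conjE) (simp add: dvd_imp_le)
  qed
qed

theorem theorem7:
  fixes j e :: nat
  assumes "j \<ge> 4" and "j \<noteq> 6" and "e \<ge> 1"
  shows "periodic_seq (fib_pow_seq e j)
    \<and> (even j \<longrightarrow>
          (even e \<longrightarrow> fib_periodicity j e = j)
        \<and> (odd e \<longrightarrow> fib_periodicity j e = 2 * j))
    \<and> (odd j \<longrightarrow>
          (e mod 4 = 0 \<longrightarrow> fib_periodicity j e = j)
        \<and> (e mod 4 = 2 \<longrightarrow> fib_periodicity j e = 2 * j)
        \<and> (odd e \<longrightarrow> fib_periodicity j e = 4 * j))"
proof -
  \<comment> \<open>\<open>K\<close> is the order of F_(j-1) modulo F_j, which is 2 for even j and 4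
    for odd j, divided by its gcd with e.\<close>
  define K :: nat where
    "K = (if even j then if even e then 1 else 2
      else if e mod 4 = 0 then 1 else if e mod 4 = 2 then 2 else 4)"
  obtain n where n: "j = Suc n" using assms(1) by (cases j) auto
  have "[int (fib (j - 1)) ^ (k * e) = 1] (mod int (fib j)) \<longleftrightarrow> K dvd k" for k
  proof (cases "even j")
    case True
    then show ?thesis using fib_pow_cong_1_even[of n "k * e"] assms(1) n by (simp add: K_def)
  next
    case False
    have "4 dvd k * e \<longleftrightarrow> K dvd k"
    proof (cases "odd e")
      case True
      then have "coprime (2 ^ 2) e" unfolding coprime_power_left_iff by simp
      then have "coprime 4 e" by simp
      moreover have "e mod 4 \<noteq> 0" "e mod 4 \<noteq> 2" using True by presburger+
      ultimately show ?thesis using False by (simp add: K_def coprime_dvd_mult_left_iff)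
    next
      case even: False
      show ?thesis
      proof (cases "e mod 4 = 0")
        case True
        then show ?thesis using False by (auto simp: K_def)
      next
        case ne: False
        with even have e2: "e mod 4 = 2" by presburger
        \<comment> \<open>As e is twice an odd number, cancelling one factor 2 leaves the parity of
          k.\<close>
        then have "e = 2 * (2 * (e div 4) + 1)" by presburger
        then obtain h where h: "e = 2 * (2 * h + 1)" by blast
        have "(4 :: nat) = 2 * 2" and "k * e = 2 * (k * (2 * h + 1))" by (simp_all add: h)
        then have "4 dvd k * e \<longleftrightarrow> 2 * 2 dvd 2 * (k * (2 * h + 1))" by (simp only:)
        also have "\<dots> \<longleftrightarrow> 2 dvd k * (2 * h + 1)" by (rule nat_mult_dvd_cancel1) simp
        also have "\<dots> \<longleftrightarrow> 2 dvd k" by simp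
        finally show ?thesis using False e2 by (simp add: K_def)
      qed
    qed
    then show ?thesis using fib_pow_cong_1_odd[of n "k * e"] False assms(1) n by simp
  qed
  moreover have "K \<ge> 1" by (simp add: K_def)
  ultimately have "is_period (fib_pow_seq e j) (K * j)" and "fib_periodicity j e = K * j"
    using fib_periodicity_eqI[OF assms] by blast+
  moreover have "e mod 4 \<noteq> 0" "e mod 4 \<noteq> 2" if "odd e" using that by presburger+
  moreover have "even e" if "e mod 4 = 0 \<or> e mod 4 = 2" using that by presburger
  ultimately show ?thesis unfolding periodic_seq_def by (auto simp: K_def)
qed

end
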